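(* Let $r\ge 1$ and let $M$ be a binary matroid of rank at most $r$ (that is, a member of $\mathcal{M}_r$) such that $M$ is not isomorphic to $U_{0,0}$ or $U_{1,1}$. Then $M$ can be obtained from $P_r$ via a finite sequence of operations each of which is a local complementation or a pointed swap.
   Context: $P_r=PG(r-1,2)$ is the rank-$r$ binary projective geometry, i.e. the simple binary matroid on the nonzero vectors of $GF(2)^r$. $\mathcal{M}_r$ is the set of all restrictions of the fixed matroid $P_r$ (to arbitrary subsets of $E(P_r)$). All binary matroids considered are simple, and a binary matroid of rank at most $r$ is regarded as a member of $\mathcal{M}_r$. For $M\in\mathcal{M}_r$ and $A\subseteq E(P_r)$, $M\triangle A$ denotes the restriction of $P_r$ to the symmetric difference $E(M)\bigtriangleup A$, and $\mathrm{cl}_{P_r}$ is closure in $P_r$. Local complementation with respect to a cocircuit $C^*$ of $P_r$ is $\lambda_{C^*}(M)=M\triangle[\mathrm{cl}_{P_r}(E(M)\cap C^* )-C^*]$; any cocircuit of $P_r$ may be used. Pointed swap: for $M\in\mathcal{M}_r$, colour an element of $P_r$ green if it is in $E(M)$ and red otherwise. Let $f\in E(P_r)$. The pointed swap of $M$ with respect to $f$ is the matroid in $\mathcal{M}_r$ whose ground set is the set of green elements after, for every line $\{f,f',f''\}$ of $P_r$ through $f$, swapping the colours of $f'$ and $f''$ if these colours differ; the colour of $f$ is unchanged. (Equivalently, identifying elements with nonzero vectors, each $e\ne f$ in $E(M)$ is replaced by $e+f$, while $f$ remains in the ground set if and only if $f\in E(M)$.) Pointed swaps may be done with respect to any $f\in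 E(P_r)$. *)

theory Defs
  imports "HOL-Analysis.Analysis" "HOL-Library.Z2"
begin

section \<open>Matroids via independent sets\<close>

record 'a matroid =
  ground :: "'a set"
  indep :: "'a set set"

definition is_matroid :: "'a matroid \<Rightarrow> bool" where
  "is_matroid M \<longleftrightarrow>
     finite (ground M) \<and> indep M \<subseteq> Pow (ground M) \<and> {} \<in> indep M \<and>
     (\<forall>I\<in>indep M. \<forall>J. J \<subseteq> I \<longrightarrow> J \<in> indep M) \<and>
     (\<forall>I\<in>indep M. \<forall>J\<in>indep M. card I < card J \<longrightarrow> (\<exists>x\<in>J - I. insert x I \<in> indep M))"

definition restriction :: "'a matroid \<Rightarrow> 'a set \<Rightarrow> 'a matroid" where
  "restriction M X = \<lparr>ground = ground M \<inter> X, indep = {I \<in> indep M. I \<subseteq> X}\<rparr>"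

lemma is_matroid_restriction:
  assumes "is_matroid M"
  shows "is_matroid (restriction M X)"
proof -
  have aug: "\<exists>x\<in>J - I. insert x I \<in> indep M \<and> insert x I \<subseteq> X"
    if "I \<in> indep M" "I \<subseteq> X" "J \<in> indep M" "J \<subseteq> X" "card I < card J" for I J
  proof -
    obtain x where "x \<in> J - I" "insert x I \<in> indep M"
      using assms \<open>I \<in> indep M\<close> \<open>J \<in> indep M\<close> \<open>card I < card J\<close>
      unfolding is_matroid_def by metis
    then show ?thesis using that by blast
  qed
  have down: "J \<in> indep M" if "I \<in> indep M" "J \<subseteq> I" for I J
    using assms that unfolding is_matroid_def by metis
  have rest: "finite (ground M)" "indep M \<subseteq> Pow (ground M)" "{} \<in> indep M"
    using assms unfolding is_matroid_def by blast+
  have dn: "\<forall>I\<in>{I \<in> indep M. I \<subseteq> X}. \<forall>J. J \<subseteq> I \<longrightarrow> J \<in> {I \<in> indep M. I \<subseteq> X}"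
    using down by blast
  have ag: "\<forall>I\<in>{I \<in> indep M. I \<subseteq> X}. \<forall>J\<in>{I \<in> indep M. I \<subseteq> X}.
      card I < card J \<longrightarrow> (\<exists>x\<in>J - I. insert x I \<in> {I \<in> indep M. I \<subseteq> X})"
    using aug by blast
  have gr: "{I \<in> indep M. I \<subseteq> X} \<subseteq> Pow (ground M \<inter> X)"
    using rest(2) by blast
  have fin: "finite (ground M \<inter> X)"
    using rest(1) by blast
  have emp: "{} \<in> {I \<in> indep M. I \<subseteq> X}"
    using rest(3) by blast
  show ?thesis
    unfolding is_matroid_def restriction_def matroid.simps
    by (intro conjI fin gr emp dn ag)
qed

definition matroid_iso :: "'a matroid \<Rightarrow> 'b matroid \<Rightarrow> bool" where
  "matroid_iso M N \<longleftrightarrow>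
     (\<exists>\<phi>. bij_betw \<phi> (ground M) (ground N) \<and>
        (\<forall>I\<subseteq>ground M. I \<in> indep M \<longleftrightarrow> \<phi> ` I \<in> indep N))"

text \<open>The uniform matroid \<open>U\<^bsub>k,n\<^esub>\<close>.\<close>

definition uniform_matroid :: "nat \<Rightarrow> nat \<Rightarrow> nat matroid" where
  "uniform_matroid k n = \<lparr>ground = {..<n}, indep = {I. I \<subseteq> {..<n} \<and> card I \<le> k}\<rparr>"

definition matroid_rank :: "'a matroid \<Rightarrow> 'a set \<Rightarrow> nat" where
  "matroid_rank M X = Max (card ` {I \<in> indep M. I \<subseteq> X})"

definition matroid_closure :: "'a matroid \<Rightarrow> 'a set \<Rightarrow> 'a set" where
  "matroid_closure M X = {e \<in> ground M. matroid_rank M (insert e X) = matroid_rank M X}"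

definition matroid_flat :: "'a matroid \<Rightarrow> 'a set \<Rightarrow> bool" where
  "matroid_flat M F \<longleftrightarrow> F \<subseteq> ground M \<and> matroid_closure M F = F"

definition matroid_line :: "'a matroid \<Rightarrow> 'a set \<Rightarrow> bool" where
  "matroid_line M L \<longleftrightarrow> matroid_flat M L \<and> matroid_rank M L = 2"

definition matroid_basis :: "'a matroid \<Rightarrow> 'a set \<Rightarrow> bool" where
  "matroid_basis M B \<longleftrightarrow> B \<in> indep M \<and> (\<forall>I\<in>indep M. B \<subseteq> I \<longrightarrow> I = B)"

definition matroid_circuit :: "'a matroid \<Rightarrow> 'a set \<Rightarrow> bool" where
  "matroid_circuit M C \<longleftrightarrow> C \<subseteq> ground M \<and> C \<notin> indep M \<and> (\<forall>D. D \<subset> C \<longrightarrow> D \<in> indep M)"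

text \<open>The bases of the dual are the complements of the bases, so a set is independent in the
  dual iff it misses some basis.\<close>

definition matroid_dual :: "'a matroid \<Rightarrow> 'a matroid" where
  "matroid_dual M =
     \<lparr>ground = ground M, indep = {I. I \<subseteq> ground M \<and> (\<exists>B. matroid_basis M B \<and> I \<inter> B = {})}\<rparr>"

definition matroid_cocircuit :: "'a matroid \<Rightarrow> 'a set \<Rightarrow> bool" where
  "matroid_cocircuit M C \<longleftrightarrow> matroid_circuit (matroid_dual M) C"


instance bit :: finite
proof
  have "(UNIV :: bit set) \<subseteq> {0, 1}" using bit.exhaust by auto
  then show "finite (UNIV :: bit set)" by (rule finite_subset) simp
qed

section \<open>The binary projective geometry and its restrictions\<close>

text \<open>\<open>bit\<close> is the field GF(2) and \<open>r = CARD('n)\<close>, which is at least 1 for every index type;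
  \<open>PG\<close> is \<open>PG(r-1,2)\<close>, and \<open>simple_binary\<close> is the set of its restrictions, all of them being
  restrictions of this one labelled matroid.\<close>

definition PG :: "(bit^'n) matroid" where
  "PG = \<lparr>ground = UNIV - {0}, indep = {I. I \<subseteq> UNIV - {0} \<and> vec.independent I}\<rparr>"

definition simple_binary :: "(bit^'n) matroid set" where
  "simple_binary = {restriction PG X |X. X \<subseteq> ground PG}"

definition sym_diff_matroid :: "(bit^'n) matroid \<Rightarrow> (bit^'n) set \<Rightarrow> (bit^'n) matroid" where
  "sym_diff_matroid M A = restriction PG (sym_diff (ground M) A)"

definition local_complement :: "(bit^'n) set \<Rightarrow> (bit^'n) matroid \<Rightarrow> (bit^'n) matroid" where
  "local_complement C M = sym_diff_matroid M (matroid_closure PG (ground M \<inter> C) - C)"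

text \<open>The ground set is the set of green points after the swap: \<open>f\<close> keeps its colour, and on a
  line \<open>{f, f', f''}\<close> the point \<open>f'\<close> receives the colour of \<open>f''\<close>, whether or not the two colours
  differ.\<close>

definition pointed_swap :: "bit^'n \<Rightarrow> (bit^'n) matroid \<Rightarrow> (bit^'n) matroid" where
  "pointed_swap f M = restriction PG
     ((ground M \<inter> {f}) \<union>
      {f'. \<exists>f''. distinct [f, f', f''] \<and> matroid_line PG {f, f', f''} \<and> f'' \<in> ground M})"

definition lc_swap_step :: "(bit^'n) matroid \<Rightarrow> (bit^'n) matroid \<Rightarrow> bool" where
  "lc_swap_step M N \<longleftrightarrow>
     (\<exists>C. matroid_cocircuit PG C \<and> N = local_complement C M) \<or>
     (\<exists>f\<in>ground PG. N = pointed_swap f M)"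

lemma is_matroid_PG: "is_matroid (PG :: (bit^'n) matroid)"
proof -
  have aug: "\<exists>x\<in>J - I. vec.independent (insert x I)"
    if I: "vec.independent I" and J: "vec.independent J" and lt: "card I < card J"
    for I J :: "(bit^'n) set"
  proof (rule ccontr)
    assume neg: "\<not> ?thesis"
    have "J \<subseteq> vec.span I"
      using neg I by (metis DiffI subsetI vec.independent_insertI vec.span_base)
    then have "card J \<le> card I"
      using vec.independent_span_bound[OF finite J] by blast
    then show False using lt by simp
  qed
  have eq: "indep (PG :: (bit^'n) matroid) = {I. vec.independent I}"
    unfolding PG_def using vec.dependent_zero by auto
  have sub: "indep (PG :: (bit^'n) matroid) \<subseteq> Pow (ground PG)"
    unfolding PG_def by auto
  have fin: "finite (ground (PG :: (bit^'n) matroid))"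
    by (rule finite)
  have empty: "{} \<in> indep (PG :: (bit^'n) matroid)"
    unfolding eq mem_Collect_eq by (rule vec.independent_empty)
  have down: "\<forall>I\<in>indep (PG :: (bit^'n) matroid). \<forall>J. J \<subseteq> I \<longrightarrow> J \<in> indep PG"
    unfolding eq mem_Collect_eq Ball_def using vec.independent_mono by metis
  have aug': "\<forall>I\<in>indep (PG :: (bit^'n) matroid). \<forall>J\<in>indep PG.
      card I < card J \<longrightarrow> (\<exists>x\<in>J - I. insert x I \<in> indep PG)"
    unfolding eq Ball_def mem_Collect_eq using aug by simp
  show ?thesis
    unfolding is_matroid_def by (intro conjI fin sub empty down aug')
qed

text \<open>Checks of the conventions: the closure of a set of points is its span without the zero
  vector, and a pointed swap replaces every point \<open>e \<noteq> f\<close> by \<open>e + f\<close>.\<close>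

lemma ground_PG: "ground (PG :: (bit^'n) matroid) = UNIV - {0}"
  by (simp add: PG_def)

lemma matroid_rank_PG:
  fixes X :: "(bit^'n) set"
  shows "matroid_rank PG X = vec.dim X"
proof -
  have eq: "indep (PG :: (bit^'n) matroid) = {I. vec.independent I}"
    unfolding PG_def using vec.dependent_zero by auto
  obtain B where B: "B \<subseteq> X" "vec.independent B" "X \<subseteq> vec.span B" "card B = vec.dim X"
    using vec.basis_exists by blast
  have le: "card I \<le> vec.dim X" if "vec.independent I" "I \<subseteq> X" for I
    using that vec.independent_card_le_dim by blast
  show ?thesis
    unfolding matroid_rank_def eq
  proof (rule Max_eqI)
    show "vec.dim X \<in> card ` {I \<in> {I. vec.independent I}. I \<subseteq> X}"
      using B by (auto intro!: image_eqI[of _ _ B])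
  qed (use le in auto)
qed

lemma matroid_closure_PG:
  fixes X :: "(bit^'n) set"
  shows "matroid_closure PG X = vec.span X - {0}"
  unfolding matroid_closure_def matroid_rank_PG
  by (auto simp: PG_def vec.dim_insert split: if_splits)

lemma bitvec_add_self [simp]: "x + x = (0 :: bit^'n)"
  by (simp add: vec_eq_iff)

lemma bitvec_add_eq_0_iff: "x + y = 0 \<longleftrightarrow> x = (y :: bit^'n)"
  by (metis add_left_cancel bitvec_add_self)

lemma span_bitvec_2: "vec.span {f, f'} = {0, f, f', f + f' :: bit^'n}"
proof
  have "x - c *s f - d *s f' = 0 \<Longrightarrow> x \<in> {0, f, f', f + f'}" for x c d
    by (cases c; cases d) (auto simp: algebra_simps)
  then show "vec.span {f, f'} \<subseteq> {0, f, f', f + f'}"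
    by (fastforce simp: vec.span_insert)
  show "{0, f, f', f + f'} \<subseteq> vec.span {f, f'}"
    by (auto intro: vec.span_base vec.span_add vec.span_zero)
qed

lemma matroid_line_PG:
  fixes f f' f'' :: "bit^'n"
  assumes "f \<noteq> 0"
  shows "distinct [f, f', f''] \<and> matroid_line PG {f, f', f''} \<longleftrightarrow>
    f' \<noteq> 0 \<and> f' \<noteq> f \<and> f'' = f + f'"
proof
  assume L: "distinct [f, f', f''] \<and> matroid_line PG {f, f', f''}"
  then have sp: "vec.span {f, f', f''} - {0} = {f, f', f''}"
    by (simp add: matroid_line_def matroid_flat_def matroid_closure_PG)
  then have "f' \<noteq> 0" by auto
  moreover have "f + f' \<noteq> 0" using L by (simp add: bitvec_add_eq_0_iff)
  moreover have "f + f' \<in> vec.span {f, f', f''}"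
    by (auto intro: vec.span_base vec.span_add)
  ultimately have "f + f' \<in> {f, f', f''}" using sp by blast
  then show "f' \<noteq> 0 \<and> f' \<noteq> f \<and> f'' = f + f'"
    using L assms \<open>f' \<noteq> 0\<close> by auto
next
  assume R: "f' \<noteq> 0 \<and> f' \<noteq> f \<and> f'' = f + f'"
  have mem: "f + f' \<in> vec.span {f', f}"
    by (auto intro: vec.span_base vec.span_add)
  have "{f, f', f''} = insert (f + f') {f', f}"
    using R by auto
  then have eq: "vec.span {f, f', f''} = vec.span {f, f'}"
    using vec.span_redundant[OF mem] by (simp add: insert_commute)
  then have sp: "vec.span {f, f', f''} = {0, f, f', f + f'}"
    by (simp only: span_bitvec_2)
  have s1: "vec.span {f'} = {0, f'}"
    using span_bitvec_2[of f' f'] by auto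
  have "vec.dim {f, f', f''} = vec.dim {f, f'}"
    using eq by (metis vec.dim_span)
  also have "\<dots> = 2"
    using R assms by (auto simp: vec.dim_insert s1)
  finally show "distinct [f, f', f''] \<and> matroid_line PG {f, f', f''}"
    using R assms sp
    by (auto simp: matroid_line_def matroid_flat_def matroid_closure_PG matroid_rank_PG ground_PG
        bitvec_add_eq_0_iff)
qed

lemma ground_pointed_swap:
  fixes f :: "bit^'n"
  assumes "f \<noteq> 0" and "ground M \<subseteq> ground PG"
  shows "ground (pointed_swap f M) = (\<lambda>e. if e = f then f else e + f) ` ground M"
proof -
  have 1: "f + (f + e) = e" for e :: "bit^'n"
    by (simp flip: add.assoc)
  have 2: "{f'. \<exists>f''. distinct [f, f', f''] \<and> matroid_line PG {f, f', f''} \<and> f'' \<in> ground M}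
      = {f'. f' \<noteq> 0 \<and> f' \<noteq> f \<and> f + f' \<in> ground M}"
    unfolding matroid_line_PG[OF assms(1)] conj_assoc[symmetric] by auto
  have 3: "{f'. f' \<noteq> 0 \<and> f' \<noteq> f \<and> f + f' \<in> ground M} = (\<lambda>e. e + f) ` (ground M - {f})"
    (is "?L = ?R")
  proof (intro equalityI subsetI)
    fix x assume "x \<in> ?L"
    then have "f + x \<in> ground M - {f}" by auto
    moreover have "x = (f + x) + f" using 1[of x] by (simp add: ac_simps)
    ultimately show "x \<in> ?R" by blast
  next
    fix x assume "x \<in> ?R"
    then obtain e where e: "e \<in> ground M" "e \<noteq> f" "x = e + f" by blast
    then have "e \<noteq> 0" using assms(2) by (auto simp: PG_def)
    moreover have "f + x = e" using 1[of e] e by (simp add: ac_simps)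
    ultimately show "x \<in> ?L"
      using e assms by (auto simp: bitvec_add_eq_0_iff)
  qed
  have 4: "(\<lambda>e. if e = f then f else e + f) ` ground M
      = (ground M \<inter> {f}) \<union> (\<lambda>e. e + f) ` (ground M - {f})"
    by auto
  have 5: "(ground M \<inter> {f}) \<union> {f'. f' \<noteq> 0 \<and> f' \<noteq> f \<and> f + f' \<in> ground M} \<subseteq> ground PG"
    using assms(1) by (auto simp: PG_def)
  show ?thesis
    unfolding pointed_swap_def 2 4 restriction_def 3[symmetric] using 5 by auto
qed

end

theory Submission
  imports Defs
begin

text \<open>Pointed swaps with respect to the three points of a line, performed one after the other,
  transpose the first and the third of these points and fix every other point of the geometry. Hence a point of the
  ground set can be exchanged for any point outside of it, and only the size of the ground set
  matters. Every size above 2 can be lowered: choose a ground set of this size that contains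
  at least two points of a cocircuit \<open>C\<close>, and all points outside \<open>C\<close> that these span; local
  complementation removes the latter. Both operations are involutions, so everything of size
  at least 2 is linked to the whole geometry.\<close>

section \<open>The operations on sets of points\<close>

lemma ground_restriction_PG: "0 \<notin> X \<Longrightarrow> ground (restriction PG X) = X"
  by (auto simp: restriction_def PG_def)

lemma restriction_PG_Int: "restriction PG ((UNIV - {0}) \<inter> X) = restriction PG X"
  by (auto simp: restriction_def PG_def)

text \<open>The point \<open>f\<close> has its own case because \<open>f + f\<close> is the zero
  vector. For \<open>f \<noteq> 0\<close> both 0 and \<open>f\<close> have image \<open>f\<close>,
  so inverting the map is restricted to nonzero vectors.\<close>

definition swap_point :: "bit^'n \<Rightarrow> bit^'n \<Rightarrow> bit^'n" where
  "swap_point f e = (if e = f then f else e + f)"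

lemma bitvec_add_cancel [simp]: "x + y + y = (x :: bit^'n)" "y + (y + x) = x"
  by (simp add: add.assoc) (simp flip: add.assoc)

lemma bitvec_add_eq_left_iff [simp]: "x + y = x \<longleftrightarrow> y = (0 :: bit^'n)" "y + x = x \<longleftrightarrow> y = 0"
  by (metis add.right_neutral add_left_cancel) (metis add.left_neutral add_right_cancel)

lemma swap_point_swap_point: "e \<noteq> 0 \<Longrightarrow> swap_point f (swap_point f e) = e"
  by (auto simp: swap_point_def)

lemma swap_point_nonzero: "f \<noteq> 0 \<Longrightarrow> e \<noteq> 0 \<Longrightarrow> swap_point f e \<noteq> 0"
  by (simp add: swap_point_def bitvec_add_eq_0_iff)

text \<open>Both directions are demanded so that two descents to pairs of points can be joined, one
  of them run backwards.\<close>

definition linked :: "(bit^'n) set \<Rightarrow> (bit^'n) set \<Rightarrow> bool" where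
  "linked X Y \<longleftrightarrow> lc_swap_step\<^sup>*\<^sup>* (restriction PG X) (restriction PG Y) \<and>
     lc_swap_step\<^sup>*\<^sup>* (restriction PG Y) (restriction PG X)"

lemma linked_refl: "linked X X"
  by (simp add: linked_def)

lemma linked_sym: "linked X Y \<Longrightarrow> linked Y X"
  by (simp add: linked_def)

lemma linked_trans [trans]: "linked X Y \<Longrightarrow> linked Y Z \<Longrightarrow> linked X Z"
  by (auto simp: linked_def)

text \<open>A pointed swap is by definition some restriction of \<open>PG\<close>, and a restriction
  of \<open>PG\<close> is determined by its ground set, which \<open>ground_pointed_swap\<close>
  computes.\<close>

lemma pointed_swap_restriction_PG:
  assumes "f \<noteq> 0" "0 \<notin> X"
  shows "pointed_swap f (restriction PG X) = restriction PG (swap_point f ` X)"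
proof -
  have "ground (restriction PG X) \<subseteq> ground PG"
    by (simp add: restriction_def)
  from ground_pointed_swap[OF assms(1) this]
  have g: "ground (pointed_swap f (restriction PG X)) = swap_point f ` X"
    using assms by (simp add: ground_restriction_PG swap_point_def[abs_def])
  obtain S where S: "pointed_swap f (restriction PG X) = restriction PG S"
    by (simp add: pointed_swap_def)
  then have "(UNIV - {0}) \<inter> S = swap_point f ` X"
    using g by (simp add: restriction_def PG_def)
  then show ?thesis
    using S restriction_PG_Int[of S] by metis
qed

lemma linked_swap:
  assumes "f \<noteq> 0" "0 \<notin> X"
  shows "linked X (swap_point f ` X)"
proof -
  have step: "lc_swap_step (restriction PG Z) (restriction PG (swap_point f ` Z))" if "0 \<notin> Z" for Z
    using pointed_swap_restriction_PG[OF assms(1) that] assms(1)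
    unfolding lc_swap_step_def by (metis DiffI UNIV_I ground_PG singletonD)
  have "0 \<notin> swap_point f ` X"
    using assms swap_point_nonzero by (metis imageE)
  moreover have "swap_point f ` swap_point f ` X = X"
  proof -
    have "swap_point f (swap_point f x) = x" if "x \<in> X" for x
      using that assms(2) by (intro swap_point_swap_point) auto
    then show ?thesis by (simp add: image_image)
  qed
  ultimately show ?thesis
    using step[OF assms(2)] step[of "swap_point f ` X"] by (simp add: linked_def r_into_rtranclp)
qed

text \<open>The toggled points lie outside \<open>C\<close>, so the trace on \<open>C\<close> and
  hence its span survive the operation. A second application toggles the same points back.\<close>

lemma linked_local_complement:
  assumes C: "matroid_cocircuit PG C" and "0 \<notin> X" "0 \<notin> Y"
    and XC: "X \<inter> C = Y \<inter> C"
    and Y: "Y = sym_diff X (vec.span (X \<inter> C) - {0} - C)"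
  shows "linked X Y"
proof -
  have step: "lc_swap_step (restriction PG Z)
      (restriction PG (sym_diff Z (vec.span (Z \<inter> C) - {0} - C)))" if "0 \<notin> Z" for Z
    using C that unfolding lc_swap_step_def local_complement_def sym_diff_matroid_def
    by (auto simp: ground_restriction_PG matroid_closure_PG)
  have "X = sym_diff Y (vec.span (Y \<inter> C) - {0} - C)"
    using Y unfolding XC by blast
  then show ?thesis
    using step[OF assms(2)] step[OF assms(3)] Y by (simp add: linked_def r_into_rtranclp)
qed

section \<open>Exchanging points\<close>

text \<open>The three translations add up to 0, so a point that never meets the centre of a swap
  returns to its place. Only two points meet a centre: \<open>f\<close> is kept, moved to
  \<open>f + g\<close> and kept again, while \<open>f + g\<close> is moved to \<open>g\<close>,
  kept, and moved to \<open>f\<close>.\<close>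

lemma swap_point_line:
  assumes "f \<noteq> 0" "g \<noteq> 0" "f \<noteq> g" "e \<noteq> 0"
  shows "swap_point (f + g) (swap_point g (swap_point f e)) = Transposition.transpose f (f + g) e"
proof -
  have "e + f + g + (f + g) = e"
    by (metis add.assoc bitvec_add_cancel(1))
  \<comment> \<open>These equivalences tell when the second and the third swap meet their centre
    after translations only; the third would need \<open>e = 0\<close>.\<close>
  moreover have "e + f = g \<longleftrightarrow> e = f + g" "e + f + g = f + g \<longleftrightarrow> e = 0"
    by (metis add.commute bitvec_add_cancel(1)) (simp add: add.assoc)
  moreover have "g + f + (f + g) = 0" "f + (f + g) = g" "g + (f + g) = f"
    by (simp_all add: ac_simps)
  ultimately show ?thesis
    using assms by (auto simp: swap_point_def Transposition.transpose_def bitvec_add_eq_0_iff add.commute)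
qed

lemma linked_exchange:
  assumes "0 \<notin> X" "e \<in> X" "e' \<notin> X" "e' \<noteq> 0"
  shows "linked X (insert e' (X - {e}))"
proof -
  \<comment> \<open>This is the third point of the line through \<open>e\<close> and
    \<open>e'\<close>. As \<open>e + ?g = e'\<close>, swaps at \<open>e\<close>, \<open>?g\<close>,
    \<open>e'\<close> transpose \<open>e\<close> and \<open>e'\<close>.\<close>
  let ?g = "e + e'"
  have ne: "e \<noteq> 0" "?g \<noteq> 0" "e \<noteq> ?g" "e + ?g \<noteq> 0"
    using assms by (auto simp: bitvec_add_eq_0_iff)
  have 1: "0 \<notin> swap_point e ` X"
    using assms(1) ne swap_point_nonzero by (metis imageE)
  then have 2: "0 \<notin> swap_point ?g ` swap_point e ` X"
    using ne swap_point_nonzero by (metis imageE)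
  have "linked X (swap_point (e + ?g) ` swap_point ?g ` swap_point e ` X)"
    using linked_swap[OF ne(1) assms(1)] linked_swap[OF ne(2) 1] linked_swap[OF ne(4) 2]
    by (meson linked_trans)
  also have "swap_point (e + ?g) ` swap_point ?g ` swap_point e ` X = Transposition.transpose e e' ` X"
    unfolding image_image
  proof (rule image_cong)
    fix x assume "x \<in> X"
    then have "x \<noteq> 0" using assms(1) by auto
    from swap_point_line[OF ne(1-3) this]
    show "swap_point (e + ?g) (swap_point ?g (swap_point e x)) = Transposition.transpose e e' x"
      by simp
  qed simp
  also have "\<dots> = insert e' (X - {e})"
    using assms by (auto simp: Transposition.transpose_def image_iff)
  finally show ?thesis .
qed

text \<open>Each exchange trades a point of \<open>X - Y\<close> for one of \<open>Y - X\<close>,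
  which exists because the sizes agree; this lowers \<open>card (X - Y)\<close> by one.\<close>

lemma linked_if_card_eq:
  fixes X Y :: "(bit^'n) set"
  assumes "0 \<notin> X" "0 \<notin> Y" "card X = card Y"
  shows "linked X Y"
  using assms
proof (induction "card (X - Y)" arbitrary: X)
  case 0
  then have "X \<subseteq> Y" by simp
  then have "X = Y" using 0 by (simp add: card_subset_eq)
  then show ?case by (simp add: linked_refl)
next
  case (Suc n)
  then obtain e where e: "e \<in> X" "e \<notin> Y"
    by (metis DiffE card.empty ex_in_conv nat.distinct(1))
  have "\<not> Y \<subseteq> X"
    using e Suc.prems(3) card_subset_eq[of X Y] by auto
  then obtain e' where e': "e' \<in> Y" "e' \<notin> X" by blast
  then have "e' \<noteq> 0" using Suc.prems by auto
  let ?X = "insert e' (X - {e})"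
  have "?X - Y = (X - Y) - {e}" using e e' by auto
  then have "n = card (?X - Y)" using Suc.hyps(2) e by simp
  moreover have "0 \<notin> ?X" using Suc.prems(1) \<open>e' \<noteq> 0\<close> by simp
  moreover have "card ?X = card Y"
    using e e' Suc.prems(3) card_Suc_Diff1[of X e] by simp
  ultimately have "linked ?X Y"
    using Suc.hyps(1) Suc.prems(2) by blast
  then show ?case
    using linked_exchange[OF Suc.prems(1) e(1) e'(2) \<open>e' \<noteq> 0\<close>] linked_trans by blast
qed

section \<open>Lowering the size\<close>

lemma vec_subspace_coordinate: "vec.subspace {v :: bit^'n. v $ i = 0}"
  by (auto simp: vec.subspace_def)

text \<open>The complement of a hyperplane is a minimal set meeting every basis: a basis inside the
  hyperplane could not span, and a proper subset of the complement is avoided by a basis of the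
  hyperplane together with one omitted point.\<close>

lemma cocircuit_coordinate: "matroid_cocircuit PG {v :: bit^'n. v $ i = 1}" (is "matroid_cocircuit PG ?C")
proof -
  let ?H = "{v :: bit^'n. v $ i = 0}"
  have HC: "v \<in> ?H \<longleftrightarrow> v \<notin> ?C" for v by (cases "v $ i") auto
  have ind: "indep (PG :: (bit^'n) matroid) = {I. vec.independent I}"
    unfolding PG_def using vec.dependent_zero by auto
  have meets: "?C \<inter> B \<noteq> {}" if B: "matroid_basis PG B" for B
  proof
    assume "?C \<inter> B = {}"
    then have "B \<subseteq> ?H" using HC by blast
    then have sp: "vec.span B \<subseteq> ?H"
      using vec_subspace_coordinate by (rule vec.span_minimal)
    have a: "axis i 1 \<in> ?C" by simp
    then have "axis i 1 \<notin> vec.span B" using sp HC by blast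
    then have "vec.independent (insert (axis i 1) B)"
      using B by (simp add: matroid_basis_def ind vec.independent_insertI)
    then have "axis i 1 \<in> B"
      using B unfolding matroid_basis_def ind by blast
    then show False using \<open>?C \<inter> B = {}\<close> a by blast
  qed
  have misses: "\<exists>B. matroid_basis PG B \<and> D \<inter> B = {}" if D: "D \<subset> ?C" for D
  proof -
    obtain c where c: "c \<in> ?C" "c \<notin> D" using psubset_imp_ex_mem[OF D] by auto
    \<comment> \<open>Chosen inside \<open>insert c ?H\<close>, the set \<open>B\<close> can meet
      \<open>?C\<close> only in \<open>c\<close>, which \<open>D\<close> omits.\<close>
    obtain B where B: "B \<subseteq> insert c ?H" "vec.independent B" "insert c ?H \<subseteq> vec.span B"
      by (rule vec.basis_exists)
    have span: "x \<in> vec.span B" for x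
    proof (cases "x \<in> ?H")
      case True
      then show ?thesis using B(3) by blast
    next
      case False
      \<comment> \<open>Both vectors have coordinate 1 at \<open>i\<close>, and 1 + 1 = 0.\<close>
      then have "x + c \<in> ?H" using c HC by auto
      then have "x + c + c \<in> vec.span B"
        using B(3) by (intro vec.span_add[of "x + c"]) blast+
      then show ?thesis by simp
    qed
    have "I = B" if I: "vec.independent I" "B \<subseteq> I" for I
      using vec.spanning_subset_independent[OF I(2,1)] span I(2) by blast
    then have "matroid_basis PG B"
      using B(2) by (simp add: matroid_basis_def ind)
    moreover have "D \<inter> B = {}"
      using B(1) D c HC by blast
    ultimately show ?thesis by blast
  qed
  have "?C \<subseteq> UNIV - {0}" by auto
  then show ?thesis
    using meets misses
    unfolding matroid_cocircuit_def matroid_circuit_def matroid_dual_def matroid.simps ground_PG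
      mem_Collect_eq by (meson psubset_imp_subset subset_trans)
qed

text \<open>The loss is strict because two points of the cocircuit sum to a point of the hyperplane;
  at least two points remain because those in the cocircuit are untouched.\<close>

lemma exists_linked_smaller:
  fixes X :: "(bit^'n) set"
  assumes "0 \<notin> X" "card X \<ge> 3"
  shows "\<exists>Y. linked X Y \<and> 0 \<notin> Y \<and> 2 \<le> card Y \<and> card Y < card X"
proof -
  fix i :: 'n
  define C H where "C = {v :: bit^'n. v $ i = 1}" and "H = {v :: bit^'n. v $ i = 0} - {0}"
  have in_C: "v \<in> C \<longleftrightarrow> v $ i = 1" and in_H: "v \<in> H \<longleftrightarrow> v $ i = 0 \<and> v \<noteq> 0" for v
    by (simp_all add: C_def H_def)
  have CH: "C \<inter> H = {}" "C \<union> H = UNIV - {0}"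
    by (auto simp: C_def H_def)
  \<comment> \<open>Translation by a vector off the hyperplane maps the hyperplane, zero included,
    onto \<open>C\<close>; hence \<open>C\<close> has one point more than \<open>H\<close>.\<close>
  have "(\<lambda>v. v + axis i 1) ` insert 0 H = C"
  proof (intro equalityI subsetI)
    fix v assume "v \<in> C"
    then have "v + axis i 1 \<in> insert 0 H" by (simp add: C_def H_def)
    then have "v + axis i 1 + axis i 1 \<in> (\<lambda>v. v + axis i 1) ` insert 0 H" by (rule imageI)
    then show "v \<in> (\<lambda>v. v + axis i 1) ` insert 0 H" by simp
  qed (auto simp: C_def H_def)
  moreover have "inj_on (\<lambda>v. v + axis i 1) (insert 0 H)"
    by (auto intro: inj_onI)
  ultimately have "card C = card (insert 0 H)"
    by (metis card_image)
  moreover have "0 \<notin> H" by (simp add: H_def)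
  ultimately have cC: "card C = Suc (card H)"
    by simp
  have "card X \<le> card (C \<union> H)"
    using assms(1) by (intro card_mono) (auto simp: CH)
  also have "\<dots> = card C + card H"
    using CH(1) by (simp add: card_Un_disjoint)
  finally have cX: "card X \<le> card C + card H" .
  \<comment> \<open>A small set is built from two points of \<open>C\<close>, a large one from all
    of \<open>H\<close>.\<close>
  obtain Y Z where Y: "Y \<subseteq> C" "card Y \<ge> 2" and Z: "Z \<subseteq> H" "vec.span Y \<inter> H \<subseteq> Z"
    and YZ: "card Y + card Z = card X"
  proof (cases "card X \<le> card C")
    case True
    have "2 \<le> card C" using cX cC assms(2) by linarith
    then obtain S where S: "S \<subseteq> C" "card S = 2"
      by (metis obtain_subset_with_card_n)
    then obtain a b where ab: "S = {a, b}" "a \<noteq> b" by (metis card_2_iff)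
    have abH: "a + b \<in> H" "a \<in> C" "b \<in> C"
      using S ab by (auto simp: C_def H_def bitvec_add_eq_0_iff)
    \<comment> \<open>The points \<open>a\<close>, \<open>b\<close> and \<open>a + b\<close>, the
      last being the only point of \<open>H\<close> spanned by the first two, account for 3; the
      rest is filled up from \<open>H\<close>.\<close>
    have "card X - 3 \<le> card (H - {a + b})"
      using True cC abH by simp
    then obtain T where T: "T \<subseteq> H - {a + b}" "card T = card X - 3"
      by (metis obtain_subset_with_card_n)
    have "card (insert (a + b) T) = Suc (card X - 3)"
      using T by (subst card_insert_disjoint) auto
    moreover have "vec.span S \<inter> H \<subseteq> insert (a + b) T"
      using ab abH CH(1) unfolding ab span_bitvec_2 by (auto simp: H_def)
    ultimately show ?thesis
      using that[of S "insert (a + b) T"] S T abH(1) assms(2) by (auto simp: subset_Diff_insert)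
  next
    case False
    \<comment> \<open>With \<open>Z = H\<close> the spanning condition is automatic. At least two
      points are left for \<open>C\<close>, since \<open>card X\<close> exceeds
      \<open>card C = Suc (card H)\<close>.\<close>
    have "card X - card H \<le> card C" using cX by simp
    then obtain S where "S \<subseteq> C" "card S = card X - card H"
      by (metis obtain_subset_with_card_n)
    then show ?thesis
      using that[of S H] False cC by auto
  qed
  let ?X = "Y \<union> Z" and ?X' = "Y \<union> (Z - vec.span Y)"
  have nz: "0 \<notin> ?X" using Y Z CH by blast
  have cXX: "card ?X = card X"
    using YZ Y(1) Z(1) CH(1) by (subst card_Un_disjoint) auto
  have int: "?X \<inter> C = Y" "?X' \<inter> C = Y"
    using Y Z CH by blast+
  have HC: "vec.span Y - {0} - C = vec.span Y \<inter> H"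
    using CH by blast
  have "linked ?X ?X'"
  proof (rule linked_local_complement)
    show "matroid_cocircuit PG C"
      unfolding C_def by (rule cocircuit_coordinate)
    \<comment> \<open>Every toggled point already lies in \<open>Z\<close>, so the symmetric
      difference only deletes.\<close>
    show "?X' = sym_diff ?X (vec.span (?X \<inter> C) - {0} - C)"
      unfolding int HC using Y Z CH by blast
  qed (use nz int in auto)
  moreover have "linked X ?X"
    using assms(1) nz cXX by (simp add: linked_if_card_eq)
  ultimately have "linked X ?X'" using linked_trans by blast
  moreover have "card ?X' < card X"
  proof -
    obtain T where "T \<subseteq> Y" "card T = 2"
      using Y(2) by (metis obtain_subset_with_card_n)
    then obtain a b where ab: "a \<in> Y" "b \<in> Y" "a \<noteq> b"
      by (auto simp: card_2_iff)
    then have "a + b \<in> vec.span Y" "a + b \<in> H"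
      using Y(1) by (auto simp: in_H in_C bitvec_add_eq_0_iff subset_iff intro: vec.span_add vec.span_base)
    moreover from this have "a + b \<in> Z" "a + b \<notin> Y"
      using Z Y(1) CH(1) by auto
    ultimately have "?X' \<subset> ?X" by blast
    then show ?thesis
      using psubset_card_mono[of ?X ?X'] cXX by simp
  qed
  moreover have "card Y \<le> card ?X'" by (rule card_mono) auto
  ultimately show ?thesis
    using nz Y(2) by (intro exI[of _ ?X']) auto
qed

lemma exists_linked_pair:
  fixes X :: "(bit^'n) set"
  assumes "0 \<notin> X" "card X \<ge> 2"
  shows "\<exists>Y. linked X Y \<and> 0 \<notin> Y \<and> card Y = 2"
  using assms
proof (induction "card X" arbitrary: X rule: less_induct)
  case less
  show ?case
  proof (cases "card X = 2")
    case True
    then show ?thesis using less.prems linked_refl by blast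
  next
    case False
    then obtain Y where "linked X Y" "0 \<notin> Y" "2 \<le> card Y" "card Y < card X"
      using exists_linked_smaller[of X] less.prems by auto
    then show ?thesis
      using less.hyps[of Y] linked_trans by blast
  qed
qed

theorem theorem6p6:
  fixes M :: "(bit^'n) matroid"
  assumes "M \<in> simple_binary"
    and "\<not> matroid_iso M (uniform_matroid 0 0)"
    and "\<not> matroid_iso M (uniform_matroid 1 1)"
  shows "lc_swap_step\<^sup>*\<^sup>* PG M"
proof -
  obtain X where M: "M = restriction PG X" and "X \<subseteq> ground PG"
    using assms(1) by (auto simp: simple_binary_def)
  then have X: "0 \<notin> X" by (auto simp: ground_PG)
  have "card X \<noteq> 0"
  proof
    assume "card X = 0"
    then have "X = {}" by simp
    then have "matroid_iso M (uniform_matroid 0 0)"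
      using vec.independent_empty
      by (auto simp: M matroid_iso_def uniform_matroid_def restriction_def PG_def bij_betw_def)
    then show False using assms(2) by simp
  qed
  moreover have "card X \<noteq> 1"
  proof
    assume "card X = 1"
    then obtain x where x: "X = {x}" "x \<noteq> 0"
      using X by (auto simp: card_1_singleton_iff)
    have "vec.independent {x}" "vec.independent ({} :: (bit^'n) set)"
      using x vec.independent_empty by auto
    \<comment> \<open>The isomorphism sends the single point to 0, the only element of
      \<open>{..<1}\<close>.\<close>
    then have "I \<in> indep M \<longleftrightarrow> (\<lambda>_. 0) ` I \<in> indep (uniform_matroid 1 1)" if "I \<subseteq> {x}" for I
      using that x by (auto simp: M uniform_matroid_def restriction_def PG_def subset_singleton_iff)
    moreover have "ground M = {x}" using x by (simp add: M ground_restriction_PG)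
    ultimately have "matroid_iso M (uniform_matroid 1 1)"
      unfolding matroid_iso_def
      by (intro exI[of _ "\<lambda>_. 0"]) (auto simp: uniform_matroid_def bij_betw_def)
    then show False using assms(3) by simp
  qed
  ultimately have cX: "card X \<ge> 2" by linarith
  let ?P = "UNIV - {0 :: bit^'n}"
  \<comment> \<open>The existence of \<open>X\<close> forces at least two points in the geometry, so
    the descent to a pair applies to \<open>PG\<close> as well.\<close>
  have "card X \<le> card ?P" using X by (intro card_mono) auto
  then have cP: "card ?P \<ge> 2" using cX by linarith
  obtain Y where Y: "linked X Y" "0 \<notin> Y" "card Y = 2"
    using exists_linked_pair[OF X cX] by blast
  obtain Z where Z: "linked ?P Z" "0 \<notin> Z" "card Z = 2"
    using exists_linked_pair[of ?P] cP by blast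
  have "linked Z Y" using Y Z by (simp add: linked_if_card_eq)
  then have "linked ?P X"
    using Y(1) Z(1) linked_sym linked_trans by blast
  moreover have "restriction PG ?P = PG"
    by (auto simp: restriction_def PG_def)
  ultimately show ?thesis
    by (simp add: linked_def M)
qed

end
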